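(* Let $a,b\in\mathbb{C}\setminus\{0\}$ with $a,b\neq\pm1$ and $a\neq b^{\pm1}$, and let $\mathcal{L}_1$ be the three-dimensional BiHom-Lie algebra over $\mathbb{C}$ with basis $\{e_1,e_2,e_3\}$, structure maps $\alpha_1=\mathrm{diag}(1,a,1/a)$, $\beta_1=\mathrm{diag}(1,b,1/b)$, and brackets $[e_1,e_2]=2b\,e_2$, $[e_1,e_3]=-\frac{2}{b}e_3$, $[e_2,e_1]=-2a\,e_2$, $[e_2,e_3]=\frac{a}{b}e_1$, $[e_3,e_1]=\frac{2}{a}e_3$, $[e_3,e_2]=-\frac{b}{a}e_1$, $[e_i,e_i]=0$. Then the families of Nijenhuis operators on $\mathcal{L}_1$ $$\mathcal{N}_1^1=\{\mathrm{diag}(r_{11},r_{11},r_{33}) : r_{11},r_{33}\in\mathbb{C}\},\qquad \mathcal{N}_1^2=\{\mathrm{diag}(r_{11},r_{22},r_{11}) : r_{11},r_{22}\in\mathbb{C}\}$$ are non-isomorphic unless they intersect: if an element of $\mathcal{N}_1^1$ is isomorphic to an element of $\mathcal{N}_1^2$, then both lie in the intersection $\mathcal{N}_1^1\cap\mathcal{N}_1^2$, i.e. are scalar matrices.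
   Context: A BiHom-Lie algebra is a 4-tuple $(L,[\cdot,\cdot],\alpha,\beta)$ with $L$ a vector space over $\mathbb{C}$, $[\cdot,\cdot]:L\times L\to L$ bilinear, $\alpha,\beta:L\to L$ linear, such that for all $x,y,z\in L$: (i) $\alpha\circ\beta=\beta\circ\alpha$; (ii) $\alpha([x,y])=[\alpha(x),\alpha(y)]$ and $\beta([x,y])=[\beta(x),\beta(y)]$; (iii) $[\beta(x),\alpha(y)]=-[\beta(y),\alpha(x)]$; (iv) $[\beta^2(x),[\beta(y),\alpha(z)]]+[\beta^2(y),[\beta(z),\alpha(x)]]+[\beta^2(z),[\beta(x),\alpha(y)]]=0$. A linear map $N:L\to L$ is a Nijenhuis operator on it if $N\circ\alpha=\alpha\circ N$, $N\circ\beta=\beta\circ N$, and $[N(x),N(y)]=N([N(x),y]+[x,N(y)]-N[x,y])$ for all $x,y\in L$. An automorphism of $(L,[\cdot,\cdot],\alpha,\beta)$ is a bijective linear map preserving the bracket and commuting with $\alpha$ and $\beta$. Two Nijenhuis operators $N,N'$ on the same BiHom-Lie algebra are isomorphic if $N'=\phi N\phi^{-1}$ for some automorphism $\phi$. *)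

theory Defs
  imports "HOL-Analysis.Analysis"
begin

locale bihom_lie_algebra = vector_space smul
  for smul :: "complex \<Rightarrow> 'v::ab_group_add \<Rightarrow> 'v" +
  fixes br :: "'v \<Rightarrow> 'v \<Rightarrow> 'v" and \<alpha> \<beta> :: "'v \<Rightarrow> 'v"
  assumes linear_br_left: "\<And>y. Vector_Spaces.linear smul smul (\<lambda>x. br x y)"
    and linear_br_right: "\<And>x. Vector_Spaces.linear smul smul (br x)"
    and linear_alpha: "Vector_Spaces.linear smul smul \<alpha>"
    and linear_beta: "Vector_Spaces.linear smul smul \<beta>"
    and alpha_beta_commute: "\<alpha> \<circ> \<beta> = \<beta> \<circ> \<alpha>"
    and alpha_br: "\<And>x y. \<alpha> (br x y) = br (\<alpha> x) (\<alpha> y)"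
    and beta_br: "\<And>x y. \<beta> (br x y) = br (\<beta> x) (\<beta> y)"
    and bihom_skew: "\<And>x y. br (\<beta> x) (\<alpha> y) = - br (\<beta> y) (\<alpha> x)"
    and bihom_jacobi:
      "\<And>x y z. br (\<beta> (\<beta> x)) (br (\<beta> y) (\<alpha> z))
              + br (\<beta> (\<beta> y)) (br (\<beta> z) (\<alpha> x))
              + br (\<beta> (\<beta> z)) (br (\<beta> x) (\<alpha> y)) = 0"

definition nijenhuis_operator ::
  "(complex \<Rightarrow> 'v::ab_group_add \<Rightarrow> 'v) \<Rightarrow> ('v \<Rightarrow> 'v \<Rightarrow> 'v) \<Rightarrow> ('v \<Rightarrow> 'v) \<Rightarrow> ('v \<Rightarrow> 'v) \<Rightarrow> ('v \<Rightarrow> 'v) \<Rightarrow> bool"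
  where "nijenhuis_operator smul br \<alpha> \<beta> N \<longleftrightarrow>
    Vector_Spaces.linear smul smul N \<and> N \<circ> \<alpha> = \<alpha> \<circ> N \<and> N \<circ> \<beta> = \<beta> \<circ> N \<and>
    (\<forall>x y. br (N x) (N y) = N (br (N x) y + br x (N y) - N (br x y)))"

definition bihom_automorphism ::
  "(complex \<Rightarrow> 'v::ab_group_add \<Rightarrow> 'v) \<Rightarrow> ('v \<Rightarrow> 'v \<Rightarrow> 'v) \<Rightarrow> ('v \<Rightarrow> 'v) \<Rightarrow> ('v \<Rightarrow> 'v) \<Rightarrow> ('v \<Rightarrow> 'v) \<Rightarrow> bool"
  where "bihom_automorphism smul br \<alpha> \<beta> \<phi> \<longleftrightarrow>
    Vector_Spaces.linear smul smul \<phi> \<and> bij \<phi> \<and>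
    (\<forall>x y. \<phi> (br x y) = br (\<phi> x) (\<phi> y)) \<and> \<phi> \<circ> \<alpha> = \<alpha> \<circ> \<phi> \<and> \<phi> \<circ> \<beta> = \<beta> \<circ> \<phi>"

definition nijenhuis_isomorphic ::
  "(complex \<Rightarrow> 'v::ab_group_add \<Rightarrow> 'v) \<Rightarrow> ('v \<Rightarrow> 'v \<Rightarrow> 'v) \<Rightarrow> ('v \<Rightarrow> 'v) \<Rightarrow> ('v \<Rightarrow> 'v) \<Rightarrow> ('v \<Rightarrow> 'v) \<Rightarrow> ('v \<Rightarrow> 'v) \<Rightarrow> bool"
  where "nijenhuis_isomorphic smul br \<alpha> \<beta> N N' \<longleftrightarrow>
    (\<exists>\<phi>. bihom_automorphism smul br \<alpha> \<beta> \<phi> \<and> N' = \<phi> \<circ> N \<circ> inv \<phi>)"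

definition L1_basis :: "3 \<Rightarrow> complex ^ 3"
  where "L1_basis i = axis i 1"

definition diag3 :: "complex \<Rightarrow> complex \<Rightarrow> complex \<Rightarrow> complex ^ 3 ^ 3"
  where "diag3 p q r = (\<chi> i j. if i = j then vector [p, q, r] $ i else 0)"

definition L1_alpha :: "complex \<Rightarrow> complex ^ 3 \<Rightarrow> complex ^ 3"
  where "L1_alpha a = (*v) (diag3 1 a (1 / a))"

definition L1_beta :: "complex \<Rightarrow> complex ^ 3 \<Rightarrow> complex ^ 3"
  where "L1_beta b = (*v) (diag3 1 b (1 / b))"

text \<open>The bilinear extension of the bracket table, which is recovered in \<open>L1_bracket_table\<close>.\<close>

definition L1_bracket :: "complex \<Rightarrow> complex \<Rightarrow> complex ^ 3 \<Rightarrow> complex ^ 3 \<Rightarrow> complex ^ 3"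
  where "L1_bracket a b x y =
      (x $ 1 * y $ 2) *s ((2 * b) *s L1_basis 2) + (x $ 1 * y $ 3) *s ((- (2 / b)) *s L1_basis 3)
    + (x $ 2 * y $ 1) *s ((- 2 * a) *s L1_basis 2) + (x $ 2 * y $ 3) *s ((a / b) *s L1_basis 1)
    + (x $ 3 * y $ 1) *s ((2 / a) *s L1_basis 3) + (x $ 3 * y $ 2) *s ((- (b / a)) *s L1_basis 1)"

lemma L1_bracket_table:
  "L1_bracket a b (L1_basis 1) (L1_basis 2) = (2 * b) *s L1_basis 2"
  "L1_bracket a b (L1_basis 1) (L1_basis 3) = (- (2 / b)) *s L1_basis 3"
  "L1_bracket a b (L1_basis 2) (L1_basis 1) = (- 2 * a) *s L1_basis 2"
  "L1_bracket a b (L1_basis 2) (L1_basis 3) = (a / b) *s L1_basis 1"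
  "L1_bracket a b (L1_basis 3) (L1_basis 1) = (2 / a) *s L1_basis 3"
  "L1_bracket a b (L1_basis 3) (L1_basis 2) = (- (b / a)) *s L1_basis 1"
  "L1_bracket a b (L1_basis i) (L1_basis i) = 0"
  using exhaust_3[of i]
  by (auto simp: L1_bracket_def L1_basis_def vec_eq_iff forall_3 axis_def)

lemma diag3_mult: "diag3 p q r *v x = vector [p * x $ 1, q * x $ 2, r * x $ 3]"
  by (simp add: diag3_def matrix_vector_mult_def vec_eq_iff forall_3 sum_3 vector_3)

lemma L1_bracket_eq:
  "L1_bracket a b x y = vector
     [a / b * (x $ 2 * y $ 3) - b / a * (x $ 3 * y $ 2),
      2 * b * (x $ 1 * y $ 2) - 2 * a * (x $ 2 * y $ 1),
      2 / a * (x $ 3 * y $ 1) - 2 / b * (x $ 1 * y $ 3)]"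
  by (simp add: L1_bracket_def L1_basis_def axis_def vec_eq_iff forall_3 vector_3 mult_ac)

lemma L1_bihom_lie_algebra:
  assumes "a \<noteq> 0" "b \<noteq> 0"
  shows "bihom_lie_algebra (*s) (L1_bracket a b) (L1_alpha a) (L1_beta b)"
  using assms
  by (unfold_locales;
      simp add: L1_alpha_def L1_beta_def L1_bracket_eq diag3_mult vec_eq_iff forall_3 vector_3 fun_eq_iff;
      simp add: field_simps)

definition N11 :: "(complex ^ 3 \<Rightarrow> complex ^ 3) set"
  where "N11 = {(*v) (diag3 r11 r11 r33) | r11 r33. True}"

definition N12 :: "(complex ^ 3 \<Rightarrow> complex ^ 3) set"
  where "N12 = {(*v) (diag3 r11 r22 r11) | r11 r22. True}"

end

theory Submission
  imports Defs
begin

text \<open>As \<open>a \<noteq> 0\<close> and \<open>a \<noteq> \<plusminus>1\<close>, the three eigenvalues \<open>1, a, 1/a\<close> of the structure map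
  \<open>\<alpha>\<^sub>1\<close> are distinct. A linear map that commutes with \<open>\<alpha>\<^sub>1\<close> therefore preserves each line
  \<open>\<complex>e\<^sub>i\<close>, that is, it is diagonal (\<open>diagonal_centralizer_commute\<close>), and so every automorphism
  of the algebra commutes with every diagonal operator. Conjugation by an automorphism thus
  fixes the members of both families: isomorphic members are equal
  (\<open>isomorphic_to_diagonal_imp_eq\<close>). A common member of the two families is scalar.

  That the families consist of Nijenhuis operators comes down to one equation. For
  \<open>N = diag(r\<^sub>1, r\<^sub>2, r\<^sub>3)\<close> and a bracket \<open>[e\<^sub>i, e\<^sub>j]\<close> that is a nonzero multiple of \<open>e\<^sub>k\<close> the
  Nijenhuis identity reads \<open>(r\<^sub>k - r\<^sub>i) (r\<^sub>k - r\<^sub>j) = 0\<close>. It is trivial when \<open>k \<in> {i, j}\<close>, and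
  the brackets of \<open>e\<^sub>2\<close> and \<open>e\<^sub>3\<close> leave \<open>(r\<^sub>1 - r\<^sub>2) (r\<^sub>1 - r\<^sub>3) = 0\<close>, whose two solution sets are
  the two families.\<close>

text \<open>The \<open>(i, j)\<close> entry of \<open>A D = D A\<close> is \<open>A\<^sub>i\<^sub>j d\<^sub>j = d\<^sub>i A\<^sub>i\<^sub>j\<close>, so distinct \<open>d\<^sub>i\<close> force the
  off-diagonal entries of \<open>A\<close> to vanish, and diagonal matrices commute.\<close>

lemma diagonal_centralizer_commute:
  fixes A :: "'a::field ^ 'n ^ 'n" and d e :: "'n \<Rightarrow> 'a"
  assumes "inj d"
    and comm: "A ** (\<chi> i j. if i = j then d i else 0) = (\<chi> i j. if i = j then d i else 0) ** A"
  shows "A ** (\<chi> i j. if i = j then e i else 0) = (\<chi> i j. if i = j then e i else 0) ** A"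
proof -
  have right: "(A ** (\<chi> i j. if i = j then c i else 0)) $ i $ j = A $ i $ j * c j"
    and left: "((\<chi> i j. if i = j then c i else 0) ** A) $ i $ j = c i * A $ i $ j" for c i j
    by (simp_all add: matrix_matrix_mult_def if_distrib if_distribR cong: if_cong)
  have "A $ i $ j = 0" if "i \<noteq> j" for i j
  proof -
    have "A $ i $ j * d j = d i * A $ i $ j"
      using arg_cong[OF comm, of "\<lambda>M. M $ i $ j"] by (simp only: left right)
    moreover have "d i \<noteq> d j"
      using \<open>inj d\<close> that by (simp add: inj_eq)
    ultimately show ?thesis
      by (simp add: mult.commute)
  qed
  then have "A $ i $ j * e j = e i * A $ i $ j" for i j
    by (cases "i = j") simp_all
  then show ?thesis
    by (simp add: vec_eq_iff left right)
qed

lemma commute_L1_alpha_imp_commute_diag3: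
  assumes "a \<noteq> 0" "a \<noteq> 1" "a \<noteq> -1"
    and lin: "Vector_Spaces.linear (*s) (*s) \<phi>"
    and comm: "\<phi> \<circ> L1_alpha a = L1_alpha a \<circ> \<phi>"
  shows "\<phi> \<circ> (*v) (diag3 p q r) = (*v) (diag3 p q r) \<circ> \<phi>"
proof -
  define A where "A = matrix \<phi>"
  have \<phi>: "\<phi> = (*v) A"
    using matrix_works[OF lin] by (auto simp: A_def)
  have "A ** diag3 1 a (1 / a) = diag3 1 a (1 / a) ** A"
    using comm unfolding \<phi> L1_alpha_def
    by (simp add: matrix_eq fun_eq_iff matrix_vector_mul_assoc)
  moreover have "a * a \<noteq> 1"
    using assms square_eq_1_iff by blast
  then have "inj (($) (vector [1, a, 1 / a] :: complex ^ 3))"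
    using assms by (auto simp: inj_def forall_3 field_simps)
  ultimately have "A ** diag3 p q r = diag3 p q r ** A"
    unfolding diag3_def by (rule diagonal_centralizer_commute[rotated])
  then show ?thesis
    unfolding \<phi> by (simp add: fun_eq_iff matrix_vector_mul_assoc)
qed

lemma isomorphic_to_diagonal_imp_eq:
  assumes "a \<noteq> 0" "a \<noteq> 1" "a \<noteq> -1"
    and "nijenhuis_isomorphic (*s) (L1_bracket a b) (L1_alpha a) (L1_beta b) ((*v) (diag3 p q r)) N'"
  shows "N' = (*v) (diag3 p q r)"
proof -
  from assms(4) obtain \<phi> where lin: "Vector_Spaces.linear (*s) (*s) \<phi>" and "bij \<phi>"
    and comm: "\<phi> \<circ> L1_alpha a = L1_alpha a \<circ> \<phi>"
    and N': "N' = \<phi> \<circ> (*v) (diag3 p q r) \<circ> inv \<phi>"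
    by (auto simp: nijenhuis_isomorphic_def bihom_automorphism_def)
  have "N' = (*v) (diag3 p q r) \<circ> (\<phi> \<circ> inv \<phi>)"
    by (simp only: N' commute_L1_alpha_imp_commute_diag3[OF assms(1-3) lin comm] comp_assoc)
  also have "\<phi> \<circ> inv \<phi> = id"
    using \<open>bij \<phi>\<close> by (simp add: bij_is_surj flip: surj_iff)
  finally show ?thesis
    by simp
qed

lemma nijenhuis_operator_diag3:
  assumes "p = q \<or> p = r"
  shows "nijenhuis_operator (*s) (L1_bracket a b) (L1_alpha a) (L1_beta b) ((*v) (diag3 p q r))"
proof -
  have "Vector_Spaces.linear (*s) (*s) ((*v) (diag3 p q r))"
    by (rule matrix_vector_mul_linear_gen)
  then show ?thesis
    using assms
    by (auto simp: nijenhuis_operator_def L1_alpha_def L1_beta_def L1_bracket_eq diag3_mult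
        vec_eq_iff forall_3 fun_eq_iff algebra_simps)
qed

lemma diag3_mult_vec_inject:
  "(*v) (diag3 p q r) = (*v) (diag3 p' q' r') \<longleftrightarrow> p = p' \<and> q = q' \<and> r = r'"
proof
  assume "(*v) (diag3 p q r) = (*v) (diag3 p' q' r')"
  then have "diag3 p q r *v 1 = diag3 p' q' r' *v 1"
    by simp
  then show "p = p' \<and> q = q' \<and> r = r'"
    by (simp add: diag3_mult vec_eq_iff forall_3)
qed simp

lemma diag3_scalar: "diag3 c c c = mat c"
  by (simp add: diag3_def mat_def vec_eq_iff forall_3)

lemma N11_Int_N12: "N11 \<inter> N12 = {(*v) (mat c) | c. True}"
  by (auto simp: N11_def N12_def diag3_mult_vec_inject simp flip: diag3_scalar)

theorem theorem10p2:
  fixes a b :: complex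
  assumes "a \<noteq> 0" and "b \<noteq> 0"
    and "a \<noteq> 1" and "a \<noteq> -1" and "b \<noteq> 1" and "b \<noteq> -1"
    and "a \<noteq> b" and "a \<noteq> inverse b"
  shows "(\<forall>N \<in> N11 \<union> N12. nijenhuis_operator (*s) (L1_bracket a b) (L1_alpha a) (L1_beta b) N)
    \<and> (\<forall>N \<in> N11. \<forall>N' \<in> N12.
          nijenhuis_isomorphic (*s) (L1_bracket a b) (L1_alpha a) (L1_beta b) N N'
          \<longrightarrow> N \<in> N11 \<inter> N12 \<and> N' \<in> N11 \<inter> N12)
    \<and> N11 \<inter> N12 = {(*v) (mat c) | c. True}"
proof (intro conjI ballI impI)
  fix N assume "N \<in> N11 \<union> N12"
  then show "nijenhuis_operator (*s) (L1_bracket a b) (L1_alpha a) (L1_beta b) N"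
    by (auto simp: N11_def N12_def nijenhuis_operator_diag3)
next
  fix N N' assume NN': "N \<in> N11" "N' \<in> N12"
    and iso: "nijenhuis_isomorphic (*s) (L1_bracket a b) (L1_alpha a) (L1_beta b) N N'"
  have "N' = N"
    using NN'(1) iso isomorphic_to_diagonal_imp_eq[OF assms(1,3,4)] by (auto simp: N11_def)
  with NN' show "N \<in> N11 \<inter> N12" "N' \<in> N11 \<inter> N12"
    by simp_all
qed (rule N11_Int_N12)

end
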